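(* Let $X$ and $Y$ be metric spaces with $X$ complete, and let $f: X \to Y$ be a continuous, uniformly open surjection. Then $f$ is density-surjective; that is, there is a subset $Z \subset X$ with $\mathrm{dens}(Z) = \mathrm{dens}(Y)$ such that the restriction $f|_Z : Z \to Y$ is surjective.
   Context: The density character $\mathrm{dens}(M)$ of a metric space $M$ is the smallest cardinality of a dense subset of $M$; a subset $Z\subset X$ is regarded as a metric space with the induced metric. $B(x,r)$ denotes the open ball of center $x$ and radius $r$. A mapping $f: X \to Y$ between metric spaces is uniformly open if for every $\varepsilon > 0$ there exists some $\delta > 0$ such that $B(f(x), \delta) \subset f(B(x, \varepsilon))$ for every $x \in X$. A surjection $f: X \to Y$ between metric spaces is density-surjective if there is a subset $Z \subset X$ with $\mathrm{dens}(Z) = \mathrm{dens}(Y)$ such that the restriction $f|_Z$ remains surjective onto $Y$. *)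

theory Defs
  imports "HOL-Analysis.Analysis"
begin

unbundle cardinal_syntax

definition dense_subset :: "'a metric \<Rightarrow> 'a set \<Rightarrow> bool" where
  "dense_subset M D \<longleftrightarrow> D \<subseteq> mspace M \<and> mtopology_of M closure_of D = mspace M"

(* Cardinals are represented by well-orders on the underlying type, as in the library, and are
   to be compared with =o and \<le>o. Hence the choice operator below only selects a
   representative of the least cardinality, which exists by dens_attained and dens_least. *)
definition dens :: "'a metric \<Rightarrow> 'a rel" where
  "dens M = (SOME r. (\<exists>D. dense_subset M D \<and> r = |D| ) \<and>
                     (\<forall>D. dense_subset M D \<longrightarrow> r \<le>o |D| ))"

lemma dens_witness:
  "(\<exists>D. dense_subset M D \<and> dens M = |D| ) \<and> (\<forall>D. dense_subset M D \<longrightarrow> dens M \<le>o |D| )"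
proof -
  have "dense_subset M (mspace M)"
    unfolding dense_subset_def by (metis closure_of_topspace order_refl topspace_mtopology_of)
  then have "\<exists>r\<in>{|D| |D. dense_subset M D}. \<forall>r'\<in>{|D| |D. dense_subset M D}. r \<le>o r'"
    by (intro exists_minim_Card_order) (auto simp: card_of_Card_order)
  then have "\<exists>r. (\<exists>D. dense_subset M D \<and> r = |D| ) \<and> (\<forall>D. dense_subset M D \<longrightarrow> r \<le>o |D| )"
    by blast
  then show ?thesis
    unfolding dens_def by (rule someI_ex)
qed

lemma dens_attained: "\<exists>D. dense_subset M D \<and> dens M = |D|"
  using dens_witness by blast

lemma dens_least: "dense_subset M D \<Longrightarrow> dens M \<le>o |D|"
  using dens_witness by blast

definition uniformly_open_map :: "'a metric \<Rightarrow> 'b metric \<Rightarrow> ('a \<Rightarrow> 'b) \<Rightarrow> bool" where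
  "uniformly_open_map X Y f \<longleftrightarrow>
     f \<in> mspace X \<rightarrow> mspace Y \<and>
     (\<forall>\<epsilon>>0. \<exists>\<delta>>0. \<forall>x\<in>mspace X. mball_of Y (f x) \<delta> \<subseteq> f ` mball_of X x \<epsilon>)"

definition density_surjective :: "'a metric \<Rightarrow> 'b metric \<Rightarrow> ('a \<Rightarrow> 'b) \<Rightarrow> bool" where
  "density_surjective X Y f \<longleftrightarrow>
     f ` mspace X = mspace Y \<and>
     (\<exists>Z\<subseteq>mspace X. dens (submetric X Z) =o dens Y \<and> f ` Z = mspace Y)"

end

theory Submission
  imports Defs
begin

text \<open>Let \<open>D\<close> be a dense subset of \<open>Y\<close> of least cardinality. A continuous surjection
  does not raise the density character (\<open>dens_le_of_continuous_surjection\<close>), so it suffices to find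
  a set \<open>Z\<close> that \<open>f\<close> maps onto \<open>Y\<close> and that has a dense subset of size at most \<open>|D|\<close>.

  If \<open>D\<close> is finite, then \<open>D = Y\<close>, and \<open>Z\<close> may contain one preimage of each point of \<open>Y\<close>.

  If \<open>D\<close> is infinite, the idea is that of the open mapping theorem. Uniform openness gives
  \<open>\<delta>\<^sub>n > 0\<close> such that any \<open>d\<close> within \<open>\<delta>\<^sub>n\<close> of \<open>f a\<close> lifts to some \<open>x\<close> with \<open>f x = d\<close> within
  \<open>(1/2)\<^sup>n\<close> of \<open>a\<close>. Fix such lifts, start with a preimage of each point of \<open>D\<close>, and
  in step \<open>n\<close> lift all admissible points of \<open>D\<close> along all points found in the previous step
  (\<open>lift_level\<close>). Every step, and hence the union \<open>A\<close> of the countably many steps, has at most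
  \<open>|D|\<close> points. Let \<open>Z\<close> be the closure of \<open>A\<close>. A point \<open>y\<close> of \<open>Y\<close> is the limit of a sequence in
  \<open>D\<close> that converges so fast that it lifts step by step to a sequence in \<open>A\<close> with successive
  distances below \<open>(1/2)\<^sup>n\<close>. By completeness the lifted sequence has a limit; it lies in \<open>Z\<close> and
  \<open>f\<close> maps it to \<open>y\<close> by continuity (\<open>closure_lift_levels_onto\<close>).\<close>

section \<open>Density characters\<close>

text \<open>The image of a dense set under a continuous surjection is dense.\<close>
lemma dens_le_of_continuous_surjection:
  assumes cont: "continuous_map (mtopology_of X) (mtopology_of Y) f"
    and onto: "f ` mspace X = mspace Y"
  shows "dens Y \<le>o dens X"
proof -
  obtain E where E: "dense_subset X E" "dens X = |E|"
    using dens_attained by blast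
  have "f ` (mtopology_of X closure_of E) \<subseteq> mtopology_of Y closure_of (f ` E)"
    using cont by (rule continuous_map_image_closure_subset)
  then have "mspace Y \<subseteq> mtopology_of Y closure_of (f ` E)"
    using E onto by (simp add: dense_subset_def)
  moreover have "mtopology_of Y closure_of (f ` E) \<subseteq> mspace Y"
    by (metis closure_of_subset_topspace topspace_mtopology_of)
  ultimately have "dense_subset Y (f ` E)"
    using E onto unfolding dense_subset_def by blast
  then have "dens Y \<le>o |f ` E|"
    by (rule dens_least)
  also have "|f ` E| \<le>o |E|"
    by (rule card_of_image)
  finally show ?thesis
    using E by simp
qed

lemma dens_closure_le:
  assumes "A \<subseteq> mspace M"
  shows "dens (submetric M (mtopology_of M closure_of A)) \<le>o |A|"
proof (rule dens_least)
  let ?Z = "mtopology_of M closure_of A"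
  have "A \<subseteq> ?Z" "?Z \<subseteq> mspace M"
    using assms by (simp add: closure_of_subset)
      (metis closure_of_subset_topspace topspace_mtopology_of)
  then show "dense_subset (submetric M ?Z) A"
    using assms
    by (auto simp: dense_subset_def mtopology_of_submetric closure_of_subtopology Int_absorb1)
qed

lemma dens_le_card: "dens M \<le>o |mspace M|"
  by (rule dens_least) (metis closure_of_topspace dense_subset_def order_refl topspace_mtopology_of)

text \<open>Finite subsets of a metric space are closed.\<close>
lemma finite_dense_subset_eq:
  assumes "dense_subset M D" "finite D"
  shows "D = mspace M"
proof -
  interpret Metric_space "mspace M" "mdist M"
    by simp
  have "closedin (mtopology_of M) D"
    using assms Hausdorff_space_mtopology
    by (simp add: dense_subset_def closedin_Hausdorff_finite mtopology_of_def)
  then show ?thesis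
    using assms by (simp add: dense_subset_def closure_of_closedin)
qed

text \<open>The reverse inequality is automatic, because \<open>f\<close> restricts to a continuous surjection of
  \<open>Z\<close> onto \<open>Y\<close>.\<close>
lemma density_surjectiveI:
  assumes cont: "continuous_map (mtopology_of X) (mtopology_of Y) f"
    and Z: "Z \<subseteq> mspace X" "f ` Z = mspace Y"
    and le: "dens (submetric X Z) \<le>o dens Y"
  shows "density_surjective X Y f"
proof -
  have "f ` mspace X \<subseteq> mspace Y"
    using continuous_map_image_subset_topspace[OF cont] by simp
  moreover have "dens Y \<le>o dens (submetric X Z)"
  proof (rule dens_le_of_continuous_surjection)
    show "continuous_map (mtopology_of (submetric X Z)) (mtopology_of Y) f"
      using cont by (simp add: mtopology_of_submetric continuous_map_from_subtopology)
    show "f ` mspace (submetric X Z) = mspace Y"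
      using Z by (simp add: Int_absorb2)
  qed
  ultimately show ?thesis
    using Z le unfolding density_surjective_def ordIso_iff_ordLeq by blast
qed

section \<open>Successive lifting along a uniformly open map\<close>

lemma (in Metric_space) MCauchy_geometric:
  assumes M: "\<And>n. \<sigma> n \<in> M"
    and step: "\<And>n. d (\<sigma> n) (\<sigma> (Suc n)) < (1/2) ^ n"
  shows "MCauchy \<sigma>"
proof -
  have tail: "d (\<sigma> N) (\<sigma> n) \<le> 2 * (1/2) ^ N" if "N \<le> n" for N n
  proof -
    \<comment> \<open>The subtracted term makes the geometric estimate inductive.\<close>
    have "d (\<sigma> N) (\<sigma> (N + k)) \<le> 2 * (1/2) ^ N - 2 * (1/2) ^ (N + k)" for k
    proof (induction k)
      case 0
      then show ?case by (simp add: M)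
    next
      case (Suc k)
      have "d (\<sigma> N) (\<sigma> (N + Suc k)) \<le> d (\<sigma> N) (\<sigma> (N + k)) + d (\<sigma> (N + k)) (\<sigma> (Suc (N + k)))"
        using triangle M by simp
      then show ?case
        using Suc step[of "N + k"] by simp
    qed
    from this[of "n - N"] have "d (\<sigma> N) (\<sigma> n) \<le> 2 * (1/2) ^ N - 2 * (1/2) ^ n"
      using that by simp
    moreover have "0 \<le> (1/2 :: real) ^ n"
      by simp
    ultimately show ?thesis
      by linarith
  qed
  have "\<exists>N. \<forall>n n'. N \<le> n \<longrightarrow> N \<le> n' \<longrightarrow> d (\<sigma> n) (\<sigma> n') < \<epsilon>" if "\<epsilon> > 0" for \<epsilon>
  proof -
    have "\<exists>N. (1/2) ^ N < \<epsilon> / 4"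
      using \<open>\<epsilon> > 0\<close> by (intro real_arch_pow_inv) auto
    then obtain N where N: "(1/2) ^ N < \<epsilon> / 4" ..
    have "d (\<sigma> n) (\<sigma> n') < \<epsilon>" if "N \<le> n" "N \<le> n'" for n n'
      using tail[OF that(1)] tail[OF that(2)] N triangle[OF M M M, of n n' N]
        commute[of "\<sigma> N" "\<sigma> n"] by linarith
    then show ?thesis by blast
  qed
  then show ?thesis
    using M unfolding MCauchy_def by blast
qed

text \<open>The radii \<open>(1/2)\<^sup>n\<close> are those of the geometric Cauchy criterion above; choosing
  the lifts once and for all is what keeps the number of points under control.\<close>
lemma uniformly_open_map_lifts:
  assumes "uniformly_open_map X Y f"
  obtains \<delta> :: "nat \<Rightarrow> real" and g
  where "\<And>n. \<delta> n > 0"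
    and "\<And>n a d. \<lbrakk>a \<in> mspace X; d \<in> mspace Y; mdist Y (f a) d < \<delta> n\<rbrakk>
           \<Longrightarrow> g n a d \<in> mspace X \<and> mdist X a (g n a d) < (1/2) ^ n \<and> f (g n a d) = d"
proof -
  have "\<forall>n. \<exists>\<delta>>0. \<forall>x\<in>mspace X. mball_of Y (f x) \<delta> \<subseteq> f ` mball_of X x ((1/2) ^ n)"
    using assms by (simp add: uniformly_open_map_def)
  then obtain \<delta> where \<delta>: "\<And>n. \<delta> n > 0"
    "\<And>n x. x \<in> mspace X \<Longrightarrow> mball_of Y (f x) (\<delta> n) \<subseteq> f ` mball_of X x ((1/2) ^ n)"
    by metis
  have lift: "\<exists>x. x \<in> mspace X \<and> mdist X a x < (1/2) ^ n \<and> f x = d"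
    if "a \<in> mspace X" "d \<in> mspace Y" "mdist Y (f a) d < \<delta> n" for n a d
  proof -
    have "f a \<in> mspace Y"
      using assms that by (auto simp: uniformly_open_map_def)
    then have "d \<in> f ` mball_of X a ((1/2) ^ n)"
      using \<delta>(2)[OF that(1), of n] that by auto
    then show ?thesis by auto
  qed
  let ?g = "\<lambda>n a d. SOME x. x \<in> mspace X \<and> mdist X a x < (1/2) ^ n \<and> f x = d"
  show ?thesis
    by (rule that[of \<delta> ?g], rule \<delta>(1), rule someI_ex, rule lift)
qed

text \<open>Here \<open>P n a d\<close> says that \<open>d\<close> is close enough to the image of \<open>a\<close> for the lift \<open>g n a d\<close>
  to be meaningful; without this guard the levels could leave the space.\<close>
primrec lift_level ::
    "('b \<Rightarrow> 'a) \<Rightarrow> (nat \<Rightarrow> 'a \<Rightarrow> 'b \<Rightarrow> 'a) \<Rightarrow> (nat \<Rightarrow> 'a \<Rightarrow> 'b \<Rightarrow> bool) \<Rightarrow> 'b set \<Rightarrow> nat \<Rightarrow> 'a set" where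
  "lift_level s g P D 0 = s ` D"
| "lift_level s g P D (Suc n) =
     (\<lambda>(a, d). g n a d) ` {(a, d) \<in> lift_level s g P D n \<times> D. P n a d}"

lemma card_of_lift_levels:
  assumes "infinite D"
  shows "|\<Union>n. lift_level s g P D n| \<le>o |D|"
proof (rule card_of_UNION_ordLeq_infinite[OF assms])
  show "|UNIV :: nat set| \<le>o |D|"
    using assms infinite_iff_card_of_nat by blast
  have "|lift_level s g P D n| \<le>o |D|" for n
  proof (induction n)
    case 0
    then show ?case by (simp add: card_of_image)
  next
    case (Suc n)
    have "|lift_level s g P D (Suc n)| \<le>o |{(a, d) \<in> lift_level s g P D n \<times> D. P n a d}|"
      by (simp add: card_of_image)
    also have "|{(a, d) \<in> lift_level s g P D n \<times> D. P n a d}| \<le>o |lift_level s g P D n \<times> D|"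
      by (rule card_of_mono1) auto
    also have "|lift_level s g P D n \<times> D| \<le>o |D|"
      using assms Suc
      by (intro card_of_Times_ordLeq_infinite_Field)
        (simp_all add: Field_card_of card_of_card_order_on card_of_mono1)
    finally show ?case .
  qed
  then show "\<forall>n\<in>UNIV. |lift_level s g P D n| \<le>o |D|"
    by blast
qed

lemma lift_level_subset:
  assumes s: "\<And>d. d \<in> D \<Longrightarrow> s d \<in> S"
    and g: "\<And>n a d. \<lbrakk>a \<in> S; d \<in> D; P n a d\<rbrakk> \<Longrightarrow> g n a d \<in> S"
  shows "lift_level s g P D n \<subseteq> S"
  by (induction n) (use s g in auto)

text \<open>Completeness turns approximate lifts into exact ones: points approximating \<open>y\<close> within
  half of the admissible tolerances can be lifted one after the other.\<close>
lemma closure_lift_levels_onto: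
  fixes X :: "'a metric" and Y :: "'b metric"
  assumes complete: "mcomplete_of X"
    and cont: "continuous_map (mtopology_of X) (mtopology_of Y) f"
    and D: "dense_subset Y D"
    and s: "\<And>d. d \<in> D \<Longrightarrow> s d \<in> mspace X \<and> f (s d) = d"
    and \<delta>: "\<And>n. \<delta> n > 0"
    and g: "\<And>n a d. \<lbrakk>a \<in> mspace X; d \<in> mspace Y; mdist Y (f a) d < \<delta> n\<rbrakk>
              \<Longrightarrow> g n a d \<in> mspace X \<and> mdist X a (g n a d) < (1/2) ^ n \<and> f (g n a d) = d"
  defines "A \<equiv> \<Union>n. lift_level s g (\<lambda>n a d. mdist Y (f a) d < \<delta> n) D n"
  shows "f ` (mtopology_of X closure_of A) = mspace Y"
proof
  have "mtopology_of X closure_of A \<subseteq> mspace X"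
    by (metis closure_of_subset_topspace topspace_mtopology_of)
  then show "f ` (mtopology_of X closure_of A) \<subseteq> mspace Y"
    using continuous_map_image_subset_topspace[OF cont] by auto
next
  interpret X: Metric_space "mspace X" "mdist X" by simp
  interpret Y: Metric_space "mspace Y" "mdist Y" by simp
  have DY: "D \<subseteq> mspace Y"
    using D by (simp add: dense_subset_def)
  show "mspace Y \<subseteq> f ` (mtopology_of X closure_of A)"
  proof
    fix y assume y: "y \<in> mspace Y"
    \<comment> \<open>The point \<open>e n\<close> must be admissible both as a target of step \<open>n - 1\<close> and as the image of
      a source of step \<open>n\<close>, whence the two tolerances (for \<open>n = 0\<close> they coincide, as
      \<open>0 - 1 = 0\<close>); the term \<open>1 / (n + 1)\<close> makes \<open>e\<close> converge to \<open>y\<close>.\<close>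
    define \<eta> where "\<eta> n = min (inverse (Suc n)) (min (\<delta> n) (\<delta> (n - 1)) / 2)" for n
    have "\<exists>d\<in>D. mdist Y y d < \<eta> n" for n
    proof -
      have "\<eta> n > 0"
        using \<delta> by (simp add: \<eta>_def)
      moreover have "y \<in> Y.mtopology closure_of D"
        using D y by (simp add: dense_subset_def mtopology_of_def)
      ultimately show ?thesis
        unfolding Y.metric_closure_of by auto
    qed
    then obtain e where e: "\<And>n. e n \<in> D" "\<And>n. mdist Y y (e n) < \<eta> n"
      by metis
    have eY: "e n \<in> mspace Y" for n
      using e DY by blast
    have e_step: "mdist Y (e n) (e (Suc n)) < \<delta> n" for n
    proof -
      have "mdist Y y (e n) < \<delta> n / 2" "mdist Y y (e (Suc n)) < \<delta> n / 2"
        using e(2)[of n] e(2)[of "Suc n"] by (auto simp: \<eta>_def min_def split: if_splits)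
      then show ?thesis
        using Y.triangle[OF eY y eY, of n "Suc n"] Y.commute[of y "e n"] by linarith
    qed
    define a where "a = rec_nat (s (e 0)) (\<lambda>n x. g n x (e (Suc n)))"
    have a_0: "a 0 = s (e 0)" and a_Suc: "a (Suc n) = g n (a n) (e (Suc n))" for n
      by (simp_all add: a_def)
    have a: "a n \<in> mspace X \<and> f (a n) = e n" for n
    proof (induction n)
      case 0
      then show ?case using s e(1) by (simp add: a_0)
    next
      case (Suc n)
      then show ?case using g[of "a n" "e (Suc n)" n] e_step eY by (simp add: a_Suc)
    qed
    have a_step: "mdist X (a n) (a (Suc n)) < (1/2) ^ n" for n
      using g[of "a n" "e (Suc n)" n] e_step[of n] eY a by (simp add: a_Suc)
    have "a n \<in> lift_level s g (\<lambda>n a d. mdist Y (f a) d < \<delta> n) D n" for n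
    proof (induction n)
      case 0
      then show ?case using e(1) by (simp add: a_0)
    next
      case (Suc n)
      then show ?case using e(1) e_step[of n] a by (force simp: a_Suc)
    qed
    then have aA: "a n \<in> A" for n
      unfolding A_def by blast
    have "X.MCauchy a"
      using a a_step by (intro X.MCauchy_geometric) auto
    then obtain z where z: "limitin (mtopology_of X) a z sequentially"
      using complete unfolding mcomplete_of_def mtopology_of_def X.mcomplete_def by blast
    have "z \<in> mtopology_of X closure_of A"
      using z a aA limitin_topspace[OF z]
      unfolding mtopology_of_def X.closure_of_sequentially by auto
    moreover have "f z = y"
    proof -
      have "limitin (mtopology_of Y) (f \<circ> a) (f z) sequentially"
        using continuous_map_limit[OF cont z] .
      moreover have "f \<circ> a = e"
        using a by (simp add: fun_eq_iff)
      moreover have "limitin (mtopology_of Y) e y sequentially"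
      proof -
        have bound: "mdist Y (e n) y \<le> inverse (real (Suc n))" for n
          using e(2)[of n] Y.commute[of y "e n"] by (simp add: \<eta>_def)
        have "(\<lambda>n. mdist Y (e n) y) \<longlonglongrightarrow> 0"
        proof (rule tendsto_sandwich[OF _ _ tendsto_const LIMSEQ_inverse_real_of_nat])
          show "\<forall>\<^sub>F n in sequentially. mdist Y (e n) y \<le> inverse (real (Suc n))"
            using bound by (intro always_eventually allI)
        qed simp
        then show ?thesis
          using y eY by (simp add: mtopology_of_def Y.limitin_metric_dist_null)
      qed
      ultimately show ?thesis
        using Y.limitin_metric_unique[of e "f z" sequentially y] by (simp add: mtopology_of_def)
    qed
    ultimately show "y \<in> f ` (mtopology_of X closure_of A)"
      by blast
  qed
qed

theorem theorem1:
  fixes X :: "'a metric" and Y :: "'b metric" and f :: "'a \<Rightarrow> 'b"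
  assumes "mcomplete_of X"
    and "continuous_map (mtopology_of X) (mtopology_of Y) f"
    and "uniformly_open_map X Y f"
    and "f ` mspace X = mspace Y"
  shows "density_surjective X Y f"
proof -
  obtain D where D: "dense_subset Y D" "dens Y = |D|"
    using dens_attained by blast
  have DY: "D \<subseteq> mspace Y"
    using D by (simp add: dense_subset_def)
  have "\<forall>d\<in>mspace Y. \<exists>x\<in>mspace X. f x = d"
    using assms(4) by (metis imageE)
  then obtain s where s: "\<And>d. d \<in> mspace Y \<Longrightarrow> s d \<in> mspace X \<and> f (s d) = d"
    by metis
  show ?thesis
  proof (cases "finite D")
    case True
    then have "D = mspace Y"
      using D finite_dense_subset_eq by blast
    show ?thesis
    proof (rule density_surjectiveI[OF assms(2)])
      show Z: "s ` D \<subseteq> mspace X"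
        using s DY by blast
      show "f ` s ` D = mspace Y"
        using s \<open>D = mspace Y\<close> by force
      have "dens (submetric X (s ` D)) \<le>o |s ` D|"
        using dens_le_card[of "submetric X (s ` D)"] Z by (simp add: Int_absorb2)
      also have "|s ` D| \<le>o |D|"
        by (rule card_of_image)
      finally show "dens (submetric X (s ` D)) \<le>o dens Y"
        using D by simp
    qed
  next
    case False
    obtain \<delta> :: "nat \<Rightarrow> real" and g where \<delta>: "\<And>n. \<delta> n > 0"
      and g: "\<And>n a d. \<lbrakk>a \<in> mspace X; d \<in> mspace Y; mdist Y (f a) d < \<delta> n\<rbrakk>
           \<Longrightarrow> g n a d \<in> mspace X \<and> mdist X a (g n a d) < (1/2) ^ n \<and> f (g n a d) = d"
      using uniformly_open_map_lifts[OF assms(3)] by blast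
    define A where "A = (\<Union>n. lift_level s g (\<lambda>n a d. mdist Y (f a) d < \<delta> n) D n)"
    have "lift_level s g (\<lambda>n a d. mdist Y (f a) d < \<delta> n) D n \<subseteq> mspace X" for n
      using s g DY by (intro lift_level_subset) blast+
    then have AX: "A \<subseteq> mspace X"
      unfolding A_def by blast
    show ?thesis
    proof (rule density_surjectiveI[OF assms(2)])
      show "mtopology_of X closure_of A \<subseteq> mspace X"
        by (metis closure_of_subset_topspace topspace_mtopology_of)
      show "f ` (mtopology_of X closure_of A) = mspace Y"
        unfolding A_def using s DY
        by (intro closure_lift_levels_onto[OF assms(1,2) D(1) _ \<delta> g]) auto
      have "dens (submetric X (mtopology_of X closure_of A)) \<le>o |A|"
        using AX by (rule dens_closure_le)
      also have "|A| \<le>o |D|"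
        unfolding A_def using False by (rule card_of_lift_levels)
      finally show "dens (submetric X (mtopology_of X closure_of A)) \<le>o dens Y"
        using D by simp
    qed
  qed
qed

end
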